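(* Let $(T(t))_{t\ge 0}$ be a bounded $C_0$-semigroup on a Hilbert space $X$, with generator $-A$, and let $B:\operatorname{dom}(A)\to X$ be a linear operator which is bounded for the graph norm on $\operatorname{dom}(A)$, and such that $T(t)Bx=BT(t)x$ for all $t\ge 0$ and $x\in\operatorname{dom}(A)$. Assume that $$\sup\left\{\|B(\lambda+A)^{-1}\| : \lambda\in\mathbb{C}_+\right\}<\infty.$$ Then $T(t)B$ extends to a bounded linear operator (also denoted by $T(t)B$) on $X$ for each $t>0$, and $\|T(t)B\|=O(t^{-1})$ as $t\to\infty$.
   Context: $\mathbb{C}_+=\{\lambda\in\mathbb{C}:\operatorname{Re}\lambda>0\}$. The generator of the semigroup is $-A$. *)

theory Defs
  imports "HOL-Analysis.Analysis" "HOL-Library.Landau_Symbols"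
begin

text \<open>
  Complex Hilbert spaces.  The library class of real inner product spaces is kept as a
  superclass: a complex inner product space carries the real inner product
  \<open>Re \<langle>x, y\<rangle>\<close>, which induces the same norm, so this is no restriction.  Positive
  definiteness of \<open>cinner\<close> is inherited from \<open>inner\<close>.
\<close>

class scaleC =
  fixes scaleC :: "complex \<Rightarrow> 'a \<Rightarrow> 'a"  (infixr \<open>*\<^sub>C\<close> 75)

class complex_inner = real_inner + scaleC +
  fixes cinner :: "'a \<Rightarrow> 'a \<Rightarrow> complex"
  assumes scaleC_add_right: "a *\<^sub>C (x + y) = a *\<^sub>C x + a *\<^sub>C y"
    and scaleC_add_left: "(a + b) *\<^sub>C x = a *\<^sub>C x + b *\<^sub>C x"
    and scaleC_scaleC: "a *\<^sub>C b *\<^sub>C x = (a * b) *\<^sub>C x"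
    and scaleC_complex_of_real: "complex_of_real r *\<^sub>C x = r *\<^sub>R x"
    and cinner_commute: "cinner x y = cnj (cinner y x)"
    and cinner_add_left: "cinner (x + y) z = cinner x z + cinner y z"
    and cinner_scaleC_left: "cinner (a *\<^sub>C x) y = a * cinner x y"
    and Re_cinner: "Re (cinner x y) = inner x y"

class chilbert_space = complex_inner + complete_space

instantiation complex :: chilbert_space
begin

definition "scaleC_complex (a :: complex) (x :: complex) = a * x"
definition "cinner_complex (x :: complex) (y :: complex) = x * cnj y"

instance
  by standard
    (auto simp: scaleC_complex_def cinner_complex_def algebra_simps scaleR_conv_of_real
      inner_complex_def)

end

definition clinear_on :: "'a::complex_inner set \<Rightarrow> ('a \<Rightarrow> 'b::complex_inner) \<Rightarrow> bool" where
  "clinear_on D f \<longleftrightarrow>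
     (\<forall>x\<in>D. \<forall>y\<in>D. f (x + y) = f x + f y) \<and> (\<forall>c. \<forall>x\<in>D. f (c *\<^sub>C x) = c *\<^sub>C f x)"

definition bounded_clinear :: "('a::complex_inner \<Rightarrow> 'b::complex_inner) \<Rightarrow> bool" where
  "bounded_clinear f \<longleftrightarrow> clinear_on UNIV f \<and> (\<exists>K. \<forall>x. norm (f x) \<le> K * norm x)"

text \<open>Only the values \<open>T t\<close> with \<open>t \<ge> 0\<close> are relevant.\<close>

definition C0_semigroup :: "(real \<Rightarrow> 'a::complex_inner \<Rightarrow> 'a) \<Rightarrow> bool" where
  "C0_semigroup T \<longleftrightarrow>
     (\<forall>t\<ge>0. bounded_clinear (T t)) \<and>
     (\<forall>x. T 0 x = x) \<and>
     (\<forall>s\<ge>0. \<forall>t\<ge>0. \<forall>x. T (s + t) x = T s (T t x)) \<and>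
     (\<forall>x. ((\<lambda>t. T t x) \<longlongrightarrow> x) (at_right 0))"

definition bounded_C0_semigroup :: "(real \<Rightarrow> 'a::complex_inner \<Rightarrow> 'a) \<Rightarrow> bool" where
  "bounded_C0_semigroup T \<longleftrightarrow> C0_semigroup T \<and> (\<exists>M. \<forall>t\<ge>0. onorm (T t) \<le> M)"

text \<open>
  An unbounded operator is given by its domain \<open>D\<close> and a total function, of which only the
  values on \<open>D\<close> matter.
\<close>

definition is_generator ::
    "(real \<Rightarrow> 'a::complex_inner \<Rightarrow> 'a) \<Rightarrow> 'a set \<Rightarrow> ('a \<Rightarrow> 'a) \<Rightarrow> bool" where
  "is_generator T D G \<longleftrightarrow>
     D = {x. \<exists>y. ((\<lambda>t. (T t x - x) /\<^sub>R t) \<longlongrightarrow> y) (at_right 0)} \<and>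
     (\<forall>x\<in>D. ((\<lambda>t. (T t x - x) /\<^sub>R t) \<longlongrightarrow> G x) (at_right 0))"

definition graph_bounded_on ::
    "'a::complex_inner set \<Rightarrow> ('a \<Rightarrow> 'a) \<Rightarrow> ('a \<Rightarrow> 'a) \<Rightarrow> bool" where
  "graph_bounded_on D A B \<longleftrightarrow> (\<exists>C. \<forall>x\<in>D. norm (B x) \<le> C * (norm x + norm (A x)))"

text \<open>
  The operator \<open>(\<lambda> + A)\<^sup>-\<^sup>1\<close>, meaningful when \<open>\<lambda> + A\<close> maps \<open>D\<close> bijectively onto the whole
  space; this holds for \<open>Re \<lambda> > 0\<close> if \<open>-A\<close> generates a bounded \<open>C\<^sub>0\<close>-semigroup.
\<close>

definition shift_inverse ::
    "'a::complex_inner set \<Rightarrow> ('a \<Rightarrow> 'a) \<Rightarrow> complex \<Rightarrow> 'a \<Rightarrow> 'a" where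
  "shift_inverse D A l = inv_into D (\<lambda>x. l *\<^sub>C x + A x)"

end

theory Submission
  imports Defs
begin

text \<open>
  The classical argument for this theorem applies Plancherel's theorem to the Laplace transforms of
  the orbits \<open>T(t)x\<close>.  The proof below carries that argument over to the implicit Euler scheme
  \<open>V = (1 + hA)\<^sup>-\<^sup>1\<close>, where Parseval's identity for finite sums suffices.

  The powers of \<open>V\<close> are bounded by the bound \<open>M\<close> of the semigroup (\<open>norm_V_power_le\<close>), because \<open>A\<close>
  is dissipative in the equivalent norm \<open>sup\<^sub>t \<parallel>T(t)x\<parallel>\<close>, in which the semigroup is contractive.
  The scheme suits the hypothesis on \<open>B\<close>: the generating function of its powers is itself a
  resolvent,
  \<open>hV(1 - zV)\<^sup>-\<^sup>1 = ((1 - z)/h + A)\<^sup>-\<^sup>1\<close>, at a point of the right half-plane for every \<open>z\<close> in the unit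
  disc.  So the supremum \<open>K\<close> of \<open>\<parallel>B(\<lambda> + A)\<^sup>-\<^sup>1\<parallel>\<close> bounds the multiplier of the discrete convolution
  with \<open>hBV\<^sup>j\<close>, and Parseval's identity makes \<open>K\<close> a bound for that convolution in the norm of
  square-summable sequences, uniformly in \<open>h\<close> (\<open>discrete_maximal_regularity\<close>, where the result of
  the convolution is finitely supported and all sums are finite).

  Convolving \<open>\<plusminus>V\<^sup>k x\<close>, with the sign plus for the first \<open>n\<close> indices and minus for the next \<open>n\<close>,
  gives \<open>hmBV\<^sup>m x\<close> up to index \<open>n\<close> and returns to zero at index \<open>2n\<close>, so that
  \<open>h\<^sup>2 (\<Sum>m\<le>n. m\<^sup>2 \<parallel>BV\<^sup>m x\<parallel>\<^sup>2)\<close> is at most a constant times \<open>n\<parallel>x\<parallel>\<^sup>2\<close>.  As \<open>\<parallel>BV\<^sup>n x\<parallel> \<le> M\<parallel>BV\<^sup>m x\<parallel>\<close> for \<open>m \<le> n\<close> and the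
  weights \<open>m\<^sup>2\<close> add up to about \<open>n\<^sup>3/3\<close>, it follows that \<open>\<parallel>BV\<^sup>n x\<parallel>\<close> is at most a constant times
  \<open>\<parallel>x\<parallel>/(nh)\<close> (\<open>norm_B_V_power_le\<close>).  Now take \<open>h = t/n\<close>.  The operator \<open>B\<close> commutes with \<open>V\<close> on the
  domain (\<open>B_V\<close>), and \<open>V\<^sup>n\<close> converges strongly to \<open>T(t)\<close> (\<open>euler_formula\<close>), so the bound passes
  to \<open>T(t)Bx\<close> for \<open>x\<close> in the domain (\<open>norm_T_B_le\<close>).  The domain is dense, and \<open>T(t)B\<close> extends to
  the whole space with the same bound (\<open>T_B_extension\<close>).
\<close>

section \<open>Complex inner product spaces\<close>

lemma cinner_self: "cinner x x = complex_of_real ((norm x)\<^sup>2)"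
proof -
  have "Im (cinner x x) = 0"
    using arg_cong[OF cinner_commute[of x x], of Im] by simp
  then show ?thesis
    by (simp add: complex_eq_iff Re_cinner power2_norm_eq_inner)
qed

lemma cinner_scaleC_right: "cinner x (a *\<^sub>C y) = cnj a * cinner x y"
  by (metis cinner_commute cinner_scaleC_left complex_cnj_mult)

lemma norm_scaleC: "norm (a *\<^sub>C x) = cmod a * norm (x :: 'a::complex_inner)"
proof -
  have "complex_of_real ((norm (a *\<^sub>C x))\<^sup>2) = (a * cnj a) * complex_of_real ((norm x)\<^sup>2)"
    by (simp only: cinner_self[symmetric] cinner_scaleC_left cinner_scaleC_right mult.assoc
        mult.left_commute[of _ "cnj a"])
  also have "\<dots> = complex_of_real ((cmod a * norm x)\<^sup>2)"
    by (simp add: complex_norm_square[symmetric] power_mult_distrib)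
  finally have "(norm (a *\<^sub>C x))\<^sup>2 = (cmod a * norm x)\<^sup>2"
    using of_real_eq_iff by blast
  then show ?thesis by simp
qed

lemma scaleC_one: "1 *\<^sub>C x = (x :: 'a::complex_inner)"
  using scaleC_complex_of_real[of 1 x] by simp

lemma scaleC_scaleR: "a *\<^sub>C r *\<^sub>R x = r *\<^sub>R a *\<^sub>C (x :: 'a::complex_inner)"
  by (metis scaleC_complex_of_real scaleC_scaleC mult.commute)

lemma bounded_bilinear_scaleC:
  "bounded_bilinear (scaleC :: complex \<Rightarrow> 'a::complex_inner \<Rightarrow> 'a)"
proof
  fix r :: real and a :: complex and b :: 'a
  show "(r *\<^sub>R a) *\<^sub>C b = r *\<^sub>R a *\<^sub>C b"
    by (metis scaleC_complex_of_real scaleC_scaleC scaleR_conv_of_real)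
  show "\<exists>K. \<forall>a b. norm (a *\<^sub>C (b::'a)) \<le> norm a * norm b * K"
    by (rule exI[of _ 1]) (simp add: norm_scaleC)
qed (simp_all add: scaleC_add_left scaleC_add_right scaleC_scaleR)

interpretation scaleC: bounded_bilinear "scaleC :: complex \<Rightarrow> 'a::complex_inner \<Rightarrow> 'a"
  by (rule bounded_bilinear_scaleC)

lemma cinner_add_right: "cinner x (y + z) = cinner x y + cinner x z"
  by (metis cinner_add_left cinner_commute complex_cnj_add)

lemma cinner_zero_left: "cinner 0 y = 0"
  using cinner_add_left[of 0 0 y] by simp

lemma cinner_zero_right: "cinner y 0 = 0"
  using cinner_add_right[of y 0 0] by simp

lemma cinner_sum_left: "cinner (sum f I) y = (\<Sum>i\<in>I. cinner (f i) y)"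
  by (induction I rule: infinite_finite_induct) (simp_all add: cinner_zero_left cinner_add_left)

lemma cinner_sum_right: "cinner y (sum f I) = (\<Sum>i\<in>I. cinner y (f i))"
  by (induction I rule: infinite_finite_induct) (simp_all add: cinner_zero_right cinner_add_right)

lemma bounded_clinear_imp_bounded_linear:
  assumes "bounded_clinear f"
  shows "bounded_linear f"
proof -
  obtain K where "\<forall>x. norm (f x) \<le> K * norm x" and "clinear_on UNIV f"
    using assms by (auto simp: bounded_clinear_def)
  then show ?thesis
    by (intro bounded_linear_intro[where K = K])
      (auto simp: clinear_on_def mult.commute simp flip: scaleC_complex_of_real)
qed

text \<open>Makes the integral of a continuous orbit available.\<close>

instance chilbert_space \<subseteq> banach ..

section \<open>The discrete Parseval identity\<close>

lemma sum_powers_root_of_unity: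
  fixes N m l :: nat
  assumes "m < N" "l < N"
  defines "\<zeta> \<equiv> cis (2 * pi / N)"
  shows "(\<Sum>k<N. (\<zeta> ^ k) ^ m * cnj ((\<zeta> ^ k) ^ l)) = (if m = l then of_nat N else 0)"
proof -
  define \<omega> where "\<omega> = \<zeta> ^ m * cnj (\<zeta> ^ l)"
  have *: "(\<zeta> ^ k) ^ m * cnj ((\<zeta> ^ k) ^ l) = \<omega> ^ k" for k
    by (simp add: \<omega>_def power_mult_distrib mult.commute flip: power_mult)
  have \<omega>: "\<omega> = cis (2 * pi * (real m - real l) / N)"
  proof -
    have "\<zeta> ^ m = cis (m * (2 * pi / N))" "cnj (\<zeta> ^ l) = cis (- (l * (2 * pi / N)))"
      by (simp_all only: \<zeta>_def Complex.DeMoivre complex_cnj_power cis_cnj mult_minus_right)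
    moreover have "m * (2 * pi / N) + - (l * (2 * pi / N)) = 2 * pi * (real m - real l) / N"
      using assms(1) by (simp add: field_simps)
    ultimately show ?thesis
      unfolding \<omega>_def by (simp only: cis_mult)
  qed
  have "\<omega> ^ N = 1"
  proof -
    have "\<omega> ^ N = cis (2 * pi * of_int (int m - int l))"
      using assms by (simp add: \<omega> Complex.DeMoivre)
    then show ?thesis by (simp add: cis_multiple_2pi)
  qed
  moreover have "\<omega> \<noteq> 1" if "m \<noteq> l"
  proof
    assume "\<omega> = 1"
    then have "cos (2 * pi * (real m - real l) / N) = 1"
      by (simp add: \<omega> complex_eq_iff)
    then obtain j :: int where "2 * pi * (real m - real l) / N = of_int j * 2 * pi"
      by (auto simp: cos_one_2pi_int)
    then have "(2 * pi) * (real m - real l) = (2 * pi) * (of_int j * N)"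
      using assms(1) by (simp add: field_simps)
    then have "real m - real l = of_int j * N"
      by (simp only: mult_cancel_left) simp
    then have "real_of_int (int m - int l) = of_int (j * int N)"
      by simp
    then have "int m - int l = j * int N"
      by (simp only: of_int_eq_iff)
    then have "int N dvd int m - int l" by simp
    moreover have "\<bar>int m - int l\<bar> < int N" using assms by linarith
    ultimately show False
      using that by (auto dest: dvd_imp_le_int[rotated])
  qed
  moreover have "\<omega> = 1" if "m = l" using that by (simp add: \<omega>)
  ultimately show ?thesis
    unfolding * by (auto simp: sum_gp_strict)
qed

text \<open>The inner sum is a polynomial of degree less than \<open>N\<close>, evaluated at the \<open>N\<close>-th roots of
  unity.  Its finitely many coefficients are recovered from these values, so that no integral over
  the circle is needed.\<close>

lemma discrete_parseval:
  fixes y :: "nat \<Rightarrow> 'a::complex_inner"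
  shows "(\<Sum>k<N. (norm (\<Sum>m<N. ((cis (2 * pi / N)) ^ k) ^ m *\<^sub>C y m))\<^sup>2) = N * (\<Sum>m<N. (norm (y m))\<^sup>2)"
proof -
  define z where "z k = (cis (2 * pi / N)) ^ k" for k
  have "complex_of_real (\<Sum>k<N. (norm (\<Sum>m<N. z k ^ m *\<^sub>C y m))\<^sup>2)
      = (\<Sum>k<N. cinner (\<Sum>m<N. z k ^ m *\<^sub>C y m) (\<Sum>l<N. z k ^ l *\<^sub>C y l))"
    by (simp add: cinner_self)
  also have "\<dots> = (\<Sum>k<N. \<Sum>l<N. \<Sum>m<N. z k ^ m * cnj (z k ^ l) * cinner (y m) (y l))"
    by (simp add: cinner_sum_left cinner_sum_right cinner_scaleC_left cinner_scaleC_right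
        mult_ac sum_distrib_left)
  also have "\<dots> = (\<Sum>l<N. \<Sum>m<N. (\<Sum>k<N. z k ^ m * cnj (z k ^ l)) * cinner (y m) (y l))"
    unfolding sum_distrib_right
    by (subst sum.swap, rule sum.cong[OF refl], rule sum.swap)
  also have "\<dots> = (\<Sum>l<N. \<Sum>m<N. (if m = l then of_nat N else 0) * cinner (y m) (y l))"
    by (intro sum.cong refl) (simp add: z_def sum_powers_root_of_unity del: complex_cnj_power)
  also have "\<dots> = (\<Sum>l<N. of_nat N * cinner (y l) (y l))"
    by (intro sum.cong refl) (simp add: if_distrib[where f="\<lambda>c. c * _"] cong: if_cong)
  also have "\<dots> = complex_of_real (N * (\<Sum>m<N. (norm (y m))\<^sup>2))"
    by (simp add: cinner_self sum_distrib_left)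
  finally show ?thesis unfolding z_def using of_real_eq_iff by blast
qed


section \<open>Bounded semigroups\<close>

locale bounded_semigroup =
  fixes T :: "real \<Rightarrow> 'a::chilbert_space \<Rightarrow> 'a" and M :: real
  assumes C0: "C0_semigroup T"
    and norm_T_le: "0 \<le> t \<Longrightarrow> norm (T t x) \<le> M * norm x"
    and M_ge_1: "1 \<le> M"
begin

lemma bounded_clinear_T: "0 \<le> t \<Longrightarrow> bounded_clinear (T t)"
  using C0 by (simp add: C0_semigroup_def)

lemma bounded_linear_T: "0 \<le> t \<Longrightarrow> bounded_linear (T t)"
  by (rule bounded_clinear_imp_bounded_linear[OF bounded_clinear_T])

lemma T_scaleC: "0 \<le> t \<Longrightarrow> T t (c *\<^sub>C x) = c *\<^sub>C T t x"
  using bounded_clinear_T by (auto simp: bounded_clinear_def clinear_on_def)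

lemmas T_add = linear_add[OF bounded_linear.linear[OF bounded_linear_T]]
  and T_diff = linear_diff[OF bounded_linear.linear[OF bounded_linear_T]]
  and T_null = linear_0[OF bounded_linear.linear[OF bounded_linear_T]]
  and T_scaleR = linear_scale[OF bounded_linear.linear[OF bounded_linear_T]]

lemma T_zero: "T 0 x = x"
  using C0 by (simp add: C0_semigroup_def)

lemma T_plus: "0 \<le> s \<Longrightarrow> 0 \<le> t \<Longrightarrow> T (s + t) x = T s (T t x)"
  using C0 by (simp add: C0_semigroup_def)

lemma T_commute: "0 \<le> s \<Longrightarrow> 0 \<le> t \<Longrightarrow> T s (T t x) = T t (T s x)"
  by (metis T_plus add.commute)

lemma T_at_0: "((\<lambda>t. T t x) \<longlongrightarrow> x) (at_right 0)"
  using C0 by (simp add: C0_semigroup_def)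

lemma continuous_on_orbit: "continuous_on {0..} (\<lambda>t. T t x)"
  unfolding continuous_on_iff
proof (intro ballI allI impI)
  fix t e :: real assume "t \<in> {0..}" "0 < e"
  have "\<forall>\<^sub>F h in at_right 0. dist (T h x) x < e / M"
    using T_at_0 \<open>0 < e\<close> M_ge_1 by (intro tendstoD) auto
  then obtain d where "0 < d" and d: "\<And>h. 0 < h \<Longrightarrow> h < d \<Longrightarrow> dist (T h x) x < e / M"
    by (auto simp: eventually_at_right_field)
  have step: "dist (T v x) (T u x) < e" if "0 \<le> u" "u < v" "v - u < d" for u v
  proof -
    have "dist (T v x) (T u x) = norm (T u (T (v - u) x - x))"
      using that T_plus[of u "v - u" x] by (simp add: T_diff dist_norm)
    also have "\<dots> \<le> M * norm (T (v - u) x - x)"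
      using that by (intro norm_T_le)
    also have "\<dots> < e"
      using d[of "v - u"] that M_ge_1 by (simp add: dist_norm field_simps)
    finally show ?thesis .
  qed
  have "dist (T s x) (T t x) < e" if "0 \<le> s" "dist s t < d" for s
    using step[of s t] step[of t s] that \<open>t \<in> {0..}\<close> \<open>0 < e\<close>
    by (cases s t rule: linorder_cases) (auto simp: dist_real_def dist_commute)
  with \<open>0 < d\<close> show "\<exists>d>0. \<forall>s\<in>{0..}. dist s t < d \<longrightarrow> dist (T s x) (T t x) < e"
    by auto
qed

definition orbit_integral :: "real \<Rightarrow> 'a \<Rightarrow> 'a" where
  "orbit_integral p x = integral {0..p} (\<lambda>s. T s x)"

lemma orbit_integrable: "0 \<le> a \<Longrightarrow> (\<lambda>s. T s x) integrable_on {a..b}"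
  by (intro integrable_continuous_real continuous_on_subset[OF continuous_on_orbit]) auto

lemma orbit_integral_quotient_tendsto:
  assumes "0 \<le> p"
  shows "((\<lambda>h. (orbit_integral (p + h) x - orbit_integral p x) /\<^sub>R h) \<longlongrightarrow> T p x) (at_right 0)"
proof -
  have "((\<lambda>u. orbit_integral u x) has_vector_derivative T p x) (at p within {0..p + 1})"
    unfolding orbit_integral_def using assms
    by (intro integral_has_vector_derivative continuous_on_subset[OF continuous_on_orbit]) auto
  then have "((\<lambda>u. orbit_integral u x) has_vector_derivative T p x) (at p within {p..p + 1})"
    by (rule has_vector_derivative_within_subset) (use assms in auto)
  then have "((\<lambda>u. (1 / norm (u - p)) *\<^sub>R
      (orbit_integral u x - (orbit_integral p x + (u - p) *\<^sub>R T p x))) \<longlongrightarrow> 0) (at_right p)"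
    by (simp add: has_vector_derivative_def has_derivative_within at_within_Icc_at_right)
  then have "((\<lambda>h. (1 / norm h) *\<^sub>R
      (orbit_integral (p + h) x - (orbit_integral p x + h *\<^sub>R T p x))) \<longlongrightarrow> 0) (at_right 0)"
    by (subst (asm) filterlim_at_right_to_0) (simp add: add.commute)
  then have "((\<lambda>h. (orbit_integral (p + h) x - orbit_integral p x) /\<^sub>R h - T p x) \<longlongrightarrow> 0) (at_right 0)"
    by (rule Lim_transform_eventually)
      (auto simp: eventually_at_right_less algebra_simps divide_inverse
        intro!: eventually_mono[OF eventually_at_right_less])
  then show ?thesis by (rule LIM_zero_cancel)
qed

lemma T_orbit_integral:
  assumes "0 \<le> p" "0 \<le> h"
  shows "T h (orbit_integral p x) = orbit_integral (p + h) x - orbit_integral h x"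
proof -
  have "T h (orbit_integral p x) = integral {0..p} (T h \<circ> (\<lambda>s. T s x))"
    unfolding orbit_integral_def
    by (rule integral_linear[symmetric]) (use assms orbit_integrable bounded_linear_T in auto)
  also have "\<dots> = integral {0..p} ((\<lambda>s. T s x) \<circ> (+) h)"
    by (rule integral_cong) (use assms in \<open>auto simp: T_plus\<close>)
  also have "\<dots> = integral {h..p + h} (\<lambda>s. T s x)"
    by (simp add: integral_shift_Icc_real)
  also have "\<dots> = orbit_integral (p + h) x - orbit_integral h x"
    unfolding orbit_integral_def using assms
    by (simp add: eq_diff_eq add.commute Henstock_Kurzweil_Integration.integral_combine orbit_integrable)
  finally show ?thesis .
qed

text \<open>The integral of an orbit lies in the domain of the generator: shifting the orbit changes
  the integral only at the two ends, where the fundamental theorem of calculus applies.\<close>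

lemma generator_orbit_integral:
  assumes "0 \<le> p"
  shows "((\<lambda>h. (T h (orbit_integral p x) - orbit_integral p x) /\<^sub>R h) \<longlongrightarrow> T p x - x) (at_right 0)"
proof -
  have "((\<lambda>h. (orbit_integral (p + h) x - orbit_integral p x) /\<^sub>R h
      - (orbit_integral (0 + h) x - orbit_integral 0 x) /\<^sub>R h) \<longlongrightarrow> T p x - T 0 x) (at_right 0)"
    using assms by (intro tendsto_diff orbit_integral_quotient_tendsto) auto
  then show ?thesis unfolding T_zero
  proof (rule Lim_transform_eventually)
    show "\<forall>\<^sub>F h in at_right 0. (orbit_integral (p + h) x - orbit_integral p x) /\<^sub>R h
        - (orbit_integral (0 + h) x - orbit_integral 0 x) /\<^sub>R h
        = (T h (orbit_integral p x) - orbit_integral p x) /\<^sub>R h"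
      using eventually_at_right_less[of "0::real"]
    proof eventually_elim
      case (elim h)
      then show ?case
        by (simp add: T_orbit_integral assms orbit_integral_def[of 0] flip: scaleR_diff_right)
    qed
  qed
qed

lemma orbit_mean_tendsto: "((\<lambda>h. orbit_integral h x /\<^sub>R h) \<longlongrightarrow> x) (at_right 0)"
  using orbit_integral_quotient_tendsto[of 0 x] by (simp add: T_zero orbit_integral_def)

text \<open>An equivalent norm in which every operator of the semigroup is a contraction.  It gives
  bounds for all powers of the resolvent from a bound for the resolvent itself.\<close>

definition orbit_norm :: "'a \<Rightarrow> real" where
  "orbit_norm x = (SUP t\<in>{0..}. norm (T t x))"

lemma norm_T_le_orbit_norm: "0 \<le> t \<Longrightarrow> norm (T t x) \<le> orbit_norm x"
  unfolding orbit_norm_def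
  by (rule cSUP_upper) (auto intro!: bdd_aboveI2[where M = "M * norm x"] norm_T_le)

lemma orbit_norm_leI: "(\<And>t. 0 \<le> t \<Longrightarrow> norm (T t x) \<le> c) \<Longrightarrow> orbit_norm x \<le> c"
  unfolding orbit_norm_def by (rule cSUP_least) auto

lemma norm_le_orbit_norm: "norm x \<le> orbit_norm x"
  using norm_T_le_orbit_norm[of 0 x] by (simp add: T_zero)

lemma orbit_norm_le: "orbit_norm x \<le> M * norm x"
  by (intro orbit_norm_leI norm_T_le)

lemma orbit_norm_scaleR_le: "orbit_norm (r *\<^sub>R x) \<le> \<bar>r\<bar> * orbit_norm x"
  by (intro orbit_norm_leI) (simp add: T_scaleR mult_left_mono norm_T_le_orbit_norm)

text \<open>Rescaling turns questions on \<open>\<lambda> + A\<close> into questions on the generator of another bounded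
  semigroup.\<close>

lemma rescaled_semigroup:
  assumes "0 \<le> Re l"
  shows "bounded_semigroup (\<lambda>t x. exp (- (t *\<^sub>R l)) *\<^sub>C T t x) M"
proof
  have *: "norm (exp (- (t *\<^sub>R l)) *\<^sub>C T t x) \<le> M * norm x" if "0 \<le> t" for t x
  proof -
    have "cmod (exp (- (t *\<^sub>R l))) \<le> 1" using assms that by simp
    then have "norm (exp (- (t *\<^sub>R l)) *\<^sub>C T t x) \<le> norm (T t x)"
      by (simp add: norm_scaleC mult_left_le_one_le)
    then show ?thesis using norm_T_le[OF that, of x] by linarith
  qed
  then show "norm (exp (- (t *\<^sub>R l)) *\<^sub>C T t x) \<le> M * norm x" if "0 \<le> t" for t x using that .
  show "C0_semigroup (\<lambda>t x. exp (- (t *\<^sub>R l)) *\<^sub>C T t x)"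
    unfolding C0_semigroup_def
  proof (intro conjI allI impI)
    fix t :: real assume t: "0 \<le> t"
    show "bounded_clinear (\<lambda>x. exp (- (t *\<^sub>R l)) *\<^sub>C T t x)"
      unfolding bounded_clinear_def clinear_on_def using *[OF t]
      by (auto simp: T_add T_scaleC t scaleC_add_right scaleC_scaleC mult.commute)
  next
    show "exp (- (0 *\<^sub>R l)) *\<^sub>C T 0 x = x" for x by (simp add: T_zero scaleC_one)
  next
    show "exp (- ((s + t) *\<^sub>R l)) *\<^sub>C T (s + t) x
        = exp (- (s *\<^sub>R l)) *\<^sub>C T s (exp (- (t *\<^sub>R l)) *\<^sub>C T t x)" if "0 \<le> s" "0 \<le> t" for s t x
      using that by (simp add: T_plus T_scaleC scaleC_scaleC scaleR_add_left exp_add[symmetric])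
  next
    show "((\<lambda>t. exp (- (t *\<^sub>R l)) *\<^sub>C T t x) \<longlongrightarrow> x) (at_right 0)" for x
    proof -
      have "((\<lambda>t. exp (- (t *\<^sub>R l))) \<longlongrightarrow> exp (- (0 *\<^sub>R l))) (at_right 0)"
        by (intro tendsto_intros)
      from scaleC.tendsto[OF this T_at_0[of x]] show ?thesis by (simp add: scaleC_one)
    qed
  qed
qed (rule M_ge_1)

end

section \<open>The resolvent of the generator\<close>

locale semigroup_generator = bounded_semigroup +
  fixes D :: "'a set" and A :: "'a \<Rightarrow> 'a"
  assumes generator: "is_generator T D (\<lambda>x. - A x)"
begin

lemma generator_tendsto: "x \<in> D \<Longrightarrow> ((\<lambda>h. (T h x - x) /\<^sub>R h) \<longlongrightarrow> - A x) (at_right 0)"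
  using generator by (simp add: is_generator_def)

lemma domainI: "((\<lambda>h. (T h x - x) /\<^sub>R h) \<longlongrightarrow> y) (at_right 0) \<Longrightarrow> x \<in> D"
  using generator by (auto simp: is_generator_def)

lemma generatorI:
  assumes "((\<lambda>h. (T h x - x) /\<^sub>R h) \<longlongrightarrow> y) (at_right 0)"
  shows "A x = - y"
  using tendsto_unique[OF _ assms generator_tendsto[OF domainI[OF assms]]] by simp

lemma generator_add:
  assumes "x \<in> D" "y \<in> D"
  shows "x + y \<in> D" "A (x + y) = A x + A y"
proof -
  have "((\<lambda>h. (T h x - x) /\<^sub>R h + (T h y - y) /\<^sub>R h) \<longlongrightarrow> - A x + - A y) (at_right 0)"
    by (intro tendsto_intros generator_tendsto assms)
  then have *: "((\<lambda>h. (T h (x + y) - (x + y)) /\<^sub>R h) \<longlongrightarrow> - A x + - A y) (at_right 0)"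
    by (rule Lim_transform_eventually)
      (auto simp: T_add algebra_simps intro!: eventually_mono[OF eventually_at_right_less])
  show "x + y \<in> D" "A (x + y) = A x + A y"
    using domainI[OF *] generatorI[OF *] by simp_all
qed

text \<open>A bounded operator may be applied to the difference quotients; this covers the operators of
  the semigroup and the scalars.\<close>

lemma generator_bounded_clinear:
  assumes "x \<in> D" and f: "bounded_clinear f" and comm: "\<And>h. 0 < h \<Longrightarrow> T h (f x) = f (T h x)"
  shows "f x \<in> D" "A (f x) = f (A x)"
proof -
  interpret f: bounded_linear f by (rule bounded_clinear_imp_bounded_linear[OF f])
  have "((\<lambda>h. f ((T h x - x) /\<^sub>R h)) \<longlongrightarrow> f (- A x)) (at_right 0)"
    by (intro f.tendsto generator_tendsto assms)
  then have *: "((\<lambda>h. (T h (f x) - f x) /\<^sub>R h) \<longlongrightarrow> - f (A x)) (at_right 0)"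
    unfolding f.neg
    by (rule Lim_transform_eventually)
      (auto simp: comm f.scaleR f.diff intro!: eventually_mono[OF eventually_at_right_less])
  show "f x \<in> D" "A (f x) = f (A x)"
    using domainI[OF *] generatorI[OF *] by simp_all
qed

lemma generator_scaleC:
  assumes "x \<in> D"
  shows "c *\<^sub>C x \<in> D" "A (c *\<^sub>C x) = c *\<^sub>C A x"
proof -
  have "bounded_clinear (\<lambda>x::'a. c *\<^sub>C x)"
    unfolding bounded_clinear_def clinear_on_def
    by (auto simp: scaleC_add_right scaleC_scaleC norm_scaleC mult.commute[of c]
        intro!: exI[of _ "cmod c"])
  from generator_bounded_clinear[OF assms this]
  show "c *\<^sub>C x \<in> D" "A (c *\<^sub>C x) = c *\<^sub>C A x" by (auto simp: T_scaleC)
qed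

lemma generator_T:
  assumes "x \<in> D" "0 \<le> t"
  shows "T t x \<in> D" "A (T t x) = T t (A x)"
  using generator_bounded_clinear[OF assms(1) bounded_clinear_T[OF assms(2)]] assms T_commute
  by auto

lemma generator_diff:
  assumes "x \<in> D" "y \<in> D"
  shows "x - y \<in> D" "A (x - y) = A x - A y"
  using generator_add[OF assms(1) generator_scaleC(1)[OF assms(2), of "-1"]]
    generator_scaleC(2)[OF assms(2), of "-1"]
  by (simp_all add: scaleC.minus_left scaleC_one)

lemma generator_scaleR:
  assumes "x \<in> D"
  shows "r *\<^sub>R x \<in> D" "A (r *\<^sub>R x) = r *\<^sub>R A x"
  using generator_scaleC[OF assms, of "of_real r"] by (simp_all add: scaleC_complex_of_real)

text \<open>For a contraction semigroup this is the dissipativity of the generator.  To first order in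
  \<open>h\<close>, the vector \<open>(1 + \<lambda>h)y\<close> is the sum of \<open>T(h)y\<close>, whose orbit norm is at most that of \<open>y\<close>, and
  \<open>h(\<lambda> + A)y\<close>.\<close>

lemma dissipative:
  assumes y: "y \<in> D" and l: "0 < Re l"
  shows "Re l * orbit_norm y \<le> orbit_norm (l *\<^sub>C y + A y)"
proof -
  define z where "z = l *\<^sub>C y + A y"
  define e where "e h = (T h y - y) /\<^sub>R h + A y" for h
  have "(e \<longlongrightarrow> - A y + A y) (at_right 0)"
    unfolding e_def by (intro tendsto_intros generator_tendsto y)
  then have "((\<lambda>h. orbit_norm z + M * norm (e h)) \<longlongrightarrow> orbit_norm z + M * norm (- A y + A y)) (at_right 0)"
    by (intro tendsto_intros)
  moreover have "Re l * orbit_norm y \<le> orbit_norm z + M * norm (e h)" if "0 < h" for h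
  proof -
    have "(1 + Re l * h) * norm (T s y) \<le> orbit_norm y + h * (orbit_norm z + M * norm (e h))"
      if "0 \<le> s" for s
    proof -
      have split: "(1 + l * of_real h) *\<^sub>C y = T h y + (h *\<^sub>R z - h *\<^sub>R e h)"
      proof -
        have "T h y = y + h *\<^sub>R (e h - A y)"
          using \<open>0 < h\<close> by (simp add: e_def)
        moreover have "(l * of_real h) *\<^sub>C y = h *\<^sub>R l *\<^sub>C y"
          by (metis scaleC_complex_of_real scaleC_scaleC mult.commute)
        ultimately show ?thesis
          by (simp add: z_def scaleC_add_left scaleC_one algebra_simps)
      qed
      have "(1 + Re l * h) * norm (T s y) \<le> cmod (1 + l * of_real h) * norm (T s y)"
        using complex_Re_le_cmod[of "1 + l * of_real h"] by (intro mult_right_mono) auto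
      also have "\<dots> = norm (T s ((1 + l * of_real h) *\<^sub>C y))"
        using that by (simp add: T_scaleC norm_scaleC)
      also have "\<dots> = norm (T (s + h) y + (h *\<^sub>R T s z - h *\<^sub>R T s (e h)))"
        unfolding split using that \<open>0 < h\<close> by (simp add: T_add T_diff T_scaleR T_plus)
      also have "\<dots> \<le> norm (T (s + h) y) + (norm (h *\<^sub>R T s z) + norm (h *\<^sub>R T s (e h)))"
        by (meson add_left_mono norm_triangle_ineq norm_triangle_ineq4 order_trans)
      also have "\<dots> = norm (T (s + h) y) + h * (norm (T s z) + norm (T s (e h)))"
        using \<open>0 < h\<close> by (simp add: algebra_simps)
      also have "\<dots> \<le> orbit_norm y + h * (orbit_norm z + M * norm (e h))"
        using that \<open>0 < h\<close>
        by (intro add_mono mult_left_mono norm_T_le_orbit_norm norm_T_le) auto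
      finally show ?thesis .
    qed
    then have "orbit_norm y \<le> (orbit_norm y + h * (orbit_norm z + M * norm (e h))) / (1 + Re l * h)"
      using l \<open>0 < h\<close> by (intro orbit_norm_leI) (simp add: pos_le_divide_eq add_pos_pos mult.commute)
    then have "h * (Re l * orbit_norm y) \<le> h * (orbit_norm z + M * norm (e h))"
      using l \<open>0 < h\<close> by (simp add: pos_le_divide_eq add_pos_pos algebra_simps)
    then show ?thesis using \<open>0 < h\<close> by simp
  qed
  then have "\<forall>\<^sub>F h in at_right 0. Re l * orbit_norm y \<le> orbit_norm z + M * norm (e h)"
    by (intro eventually_mono[OF eventually_at_right_less]) auto
  ultimately have "Re l * orbit_norm y \<le> orbit_norm z + M * norm (- A y + A y)"
    by (rule tendsto_lowerbound) simp
  then show ?thesis by (simp add: z_def)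
qed

text \<open>The integral over \<open>[0, q]\<close> of the rescaled orbit of \<open>w\<close> solves the equation with right-hand
  side \<open>w - e\<^sup>-\<^sup>\<lambda>\<^sup>q T(q)w\<close>.  For large \<open>q\<close> every \<open>x\<close> has this form, since the subtracted
  operator is then a contraction.\<close>

lemma resolvent_surj:
  assumes l: "0 < Re l"
  shows "\<exists>y\<in>D. l *\<^sub>C y + A y = x"
proof -
  define S where "S t x = exp (- (t *\<^sub>R l)) *\<^sub>C T t x" for t x
  interpret S: bounded_semigroup S M
    unfolding S_def[abs_def] by (rule rescaled_semigroup) (use l in simp)
  \<comment> \<open>The modulus of \<open>e\<^sup>-\<^sup>\<lambda>\<^sup>q\<close> is then \<open>1/(2M)\<close>.\<close>
  define q where "q = ln (2 * M) / Re l"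
  have q: "0 \<le> q" using M_ge_1 l by (simp add: q_def)
  have S_contr: "norm (S q w) \<le> 1 / 2 * norm w" for w
  proof -
    have "Re (- (q *\<^sub>R l)) = - ln (2 * M)"
      using l by (simp add: q_def)
    then have "cmod (exp (- (q *\<^sub>R l))) = exp (- ln (2 * M))"
      by (simp only: norm_exp_eq_Re)
    also have "\<dots> = inverse (exp (ln (2 * M)))"
      by (rule exp_minus)
    also have "exp (ln (2 * M)) = 2 * M"
      using M_ge_1 by (intro exp_ln) simp
    finally have "norm (S q w) = inverse (2 * M) * norm (T q w)"
      by (simp only: S_def norm_scaleC)
    also have "\<dots> \<le> inverse (2 * M) * (M * norm w)"
      using M_ge_1 q by (intro mult_left_mono norm_T_le) auto
    also have "\<dots> = 1 / 2 * norm w"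
      using M_ge_1 by (simp add: field_simps)
    finally show ?thesis .
  qed
  have "\<exists>!w. x + S q w = w"
    by (rule banach_fix_type[of "1/2"])
      (use S_contr in \<open>simp_all add: dist_norm flip: S.T_diff[OF q]\<close>)
  then obtain w where w: "x + S q w = w" by blast
  define y where "y = S.orbit_integral q w"
  have "((\<lambda>h. (S h y - y) /\<^sub>R h) \<longlongrightarrow> S q w - w) (at_right 0)"
    unfolding y_def by (rule S.generator_orbit_integral[OF q])
  also have "S q w - w = - x" by (metis w add_diff_cancel_right' minus_diff_eq)
  finally have lim_S: "((\<lambda>h. (S h y - y) /\<^sub>R h) \<longlongrightarrow> - x) (at_right 0)" .
  have "((\<lambda>h::real. exp (h *\<^sub>R l)) has_vector_derivative exp (0 *\<^sub>R l) * l) (at 0 within {0..1})"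
    by (rule exp_scaleR_has_vector_derivative_right)
  then have "((\<lambda>h::real. (1 / norm h) *\<^sub>R (exp (h *\<^sub>R l) - (1 + h *\<^sub>R l))) \<longlongrightarrow> 0) (at_right 0)"
    by (simp add: has_vector_derivative_def has_derivative_within at_within_Icc_at_right)
  then have "((\<lambda>h::real. (exp (h *\<^sub>R l) - 1) /\<^sub>R h - l) \<longlongrightarrow> 0) (at_right 0)"
  proof (rule Lim_transform_eventually)
    have "(1 / norm h) *\<^sub>R (c - (1 + h *\<^sub>R l)) = (c - 1) /\<^sub>R h - l" if "0 < h" for h :: real and c
      using that by (simp add: algebra_simps divide_inverse)
    then show "\<forall>\<^sub>F h in at_right 0. (1 / norm h) *\<^sub>R (exp (h *\<^sub>R l) - (1 + h *\<^sub>R l))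
        = (exp (h *\<^sub>R l) - 1) /\<^sub>R h - l"
      by (intro eventually_mono[OF eventually_at_right_less]) blast
  qed
  then have lim_exp: "((\<lambda>h::real. (exp (h *\<^sub>R l) - 1) /\<^sub>R h) \<longlongrightarrow> l) (at_right 0)"
    by (rule LIM_zero_cancel)
  have "((\<lambda>h. exp (h *\<^sub>R l) *\<^sub>C ((S h y - y) /\<^sub>R h) + ((exp (h *\<^sub>R l) - 1) /\<^sub>R h) *\<^sub>C y)
      \<longlongrightarrow> exp (0 *\<^sub>R l) *\<^sub>C (- x) + l *\<^sub>C y) (at_right 0)"
    by (intro tendsto_intros scaleC.tendsto lim_S lim_exp)
  then have lim: "((\<lambda>h. (T h y - y) /\<^sub>R h) \<longlongrightarrow> exp (0 *\<^sub>R l) *\<^sub>C (- x) + l *\<^sub>C y) (at_right 0)"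
  proof (rule Lim_transform_eventually)
    have "exp (h *\<^sub>R l) *\<^sub>C ((S h y - y) /\<^sub>R h) + ((exp (h *\<^sub>R l) - 1) /\<^sub>R h) *\<^sub>C y
        = (T h y - y) /\<^sub>R h" for h :: real
    proof -
      have "exp (h *\<^sub>R l) *\<^sub>C S h y = T h y"
        by (simp add: S_def scaleC_scaleC scaleC_one flip: exp_add)
      then show ?thesis
        by (simp add: scaleC_scaleR scaleC.scaleR_left scaleC.diff_left scaleC.diff_right scaleC_one
            scaleR_diff_right)
    qed
    then show "\<forall>\<^sub>F h in at_right 0. exp (h *\<^sub>R l) *\<^sub>C ((S h y - y) /\<^sub>R h)
        + ((exp (h *\<^sub>R l) - 1) /\<^sub>R h) *\<^sub>C y = (T h y - y) /\<^sub>R h" by simp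
  qed
  have "y \<in> D" "l *\<^sub>C y + A y = x"
    using domainI[OF lim] generatorI[OF lim] by (simp_all add: scaleC_one)
  then show ?thesis by blast
qed

lemma resolvent_inj:
  assumes "0 < Re l" "y \<in> D" "z \<in> D" "l *\<^sub>C y + A y = l *\<^sub>C z + A z"
  shows "y = z"
proof -
  have "l *\<^sub>C (y - z) + A (y - z) = 0"
    using assms by (simp add: generator_diff scaleC.diff_right algebra_simps)
  then have "Re l * orbit_norm (y - z) \<le> M * norm (0::'a)"
    using dissipative[OF generator_diff(1) assms(1), of y z] orbit_norm_le[of 0] assms by simp
  then have "orbit_norm (y - z) \<le> 0"
    using assms by (simp add: mult_le_0_iff)
  then have "norm (y - z) \<le> 0"
    using norm_le_orbit_norm[of "y - z"] by linarith
  then show ?thesis by simp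
qed

abbreviation R :: "complex \<Rightarrow> 'a \<Rightarrow> 'a" where "R \<equiv> shift_inverse D A"

lemma resolvent_in_domain: "0 < Re l \<Longrightarrow> R l x \<in> D"
  and resolvent_right: "0 < Re l \<Longrightarrow> l *\<^sub>C R l x + A (R l x) = x"
  unfolding shift_inverse_def using resolvent_surj[of l x]
  by (auto intro!: inv_into_into f_inv_into_f[where f = "\<lambda>x. l *\<^sub>C x + A x"])

lemma resolvent_eqI: "0 < Re l \<Longrightarrow> y \<in> D \<Longrightarrow> l *\<^sub>C y + A y = x \<Longrightarrow> R l x = y"
  by (rule resolvent_inj[of l]) (simp_all add: resolvent_in_domain resolvent_right)

lemma orbit_norm_resolvent_le:
  assumes "0 < Re l"
  shows "Re l * orbit_norm (R l x) \<le> orbit_norm x"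
  using dissipative[OF resolvent_in_domain[OF assms] assms] resolvent_right[OF assms] assms by simp

lemma bounded_clinear_resolvent:
  assumes l: "0 < Re l"
  shows "bounded_clinear (R l)"
  unfolding bounded_clinear_def clinear_on_def
proof (intro conjI ballI allI)
  fix x y c
  note [simp] = resolvent_in_domain[OF l]
  show "R l (x + y) = R l x + R l y"
    using resolvent_right[OF l, of x] resolvent_right[OF l, of y]
    by (intro resolvent_eqI[OF l]) (simp_all add: generator_add scaleC_add_right algebra_simps)
  have "l *\<^sub>C c *\<^sub>C R l x + c *\<^sub>C A (R l x) = c *\<^sub>C x"
    using resolvent_right[OF l, of x]
    by (metis scaleC_add_right scaleC_scaleC mult.commute)
  then show "R l (c *\<^sub>C x) = c *\<^sub>C R l x"
    by (intro resolvent_eqI[OF l]) (simp_all add: generator_scaleC)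
next
  have "norm (R l x) \<le> M / Re l * norm x" for x
  proof -
    have "Re l * norm (R l x) \<le> M * norm x"
      using orbit_norm_resolvent_le[OF l, of x] orbit_norm_le[of x] l
        mult_left_mono[OF norm_le_orbit_norm[of "R l x"], of "Re l"] by linarith
    then show ?thesis using l by (simp add: field_simps)
  qed
  then show "\<exists>K. \<forall>x. norm (R l x) \<le> K * norm x" by blast
qed

lemma T_resolvent:
  assumes "0 < Re l" "0 \<le> t"
  shows "T t (R l x) = R l (T t x)"
proof (rule resolvent_eqI[symmetric, OF assms(1)])
  note D = resolvent_in_domain[OF assms(1), of x]
  show "T t (R l x) \<in> D" using generator_T[OF D assms(2)] by simp
  have "T t (l *\<^sub>C R l x + A (R l x)) = T t x"
    by (simp add: resolvent_right assms)
  then show "l *\<^sub>C T t (R l x) + A (T t (R l x)) = T t x"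
    using generator_T[OF D assms(2)] assms by (simp add: T_add T_scaleC)
qed

end

section \<open>The implicit Euler scheme\<close>

context semigroup_generator
begin

text \<open>\<open>V h\<close> is \<open>(1 + hA)\<^sup>-\<^sup>1\<close>, one step of the implicit Euler scheme for \<open>x' = -Ax\<close>.\<close>

definition V :: "real \<Rightarrow> 'a \<Rightarrow> 'a" where
  "V h x = R (complex_of_real (1 / h)) (x /\<^sub>R h)"

lemma V_in_domain: "0 < h \<Longrightarrow> V h x \<in> D"
  unfolding V_def by (rule resolvent_in_domain) simp

lemma V_right:
  assumes "0 < h"
  shows "V h x + h *\<^sub>R A (V h x) = x"
proof -
  have "complex_of_real (1 / h) *\<^sub>C V h x + A (V h x) = x /\<^sub>R h"
    unfolding V_def using assms by (intro resolvent_right) simp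
  then have "h *\<^sub>R ((1 / h) *\<^sub>R V h x + A (V h x)) = h *\<^sub>R (x /\<^sub>R h)"
    by (simp only: scaleC_complex_of_real)
  then show ?thesis using assms by (simp add: scaleR_add_right)
qed

lemma V_eqI:
  assumes "0 < h" "y \<in> D" "y + h *\<^sub>R A y = x"
  shows "V h x = y"
  unfolding V_def
proof (rule resolvent_eqI)
  show "complex_of_real (1 / h) *\<^sub>C y + A y = x /\<^sub>R h"
    unfolding scaleC_complex_of_real assms(3)[symmetric] using assms(1)
    by (simp add: scaleR_add_right inverse_eq_divide)
qed (use assms in simp_all)

lemma V_add: "0 < h \<Longrightarrow> V h (x + y) = V h x + V h y"
  and V_scaleC: "0 < h \<Longrightarrow> V h (c *\<^sub>C x) = c *\<^sub>C V h x"
  using bounded_clinear_resolvent[of "complex_of_real (1 / h)"]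
  by (simp_all add: V_def bounded_clinear_def clinear_on_def scaleR_add_right
      flip: scaleC_scaleR)

lemma orbit_norm_V_le:
  assumes "0 < h"
  shows "orbit_norm (V h x) \<le> orbit_norm x"
proof -
  have "(1 / h) * orbit_norm (V h x) \<le> orbit_norm (x /\<^sub>R h)"
    using orbit_norm_resolvent_le[of "complex_of_real (1 / h)" "x /\<^sub>R h"] assms by (simp add: V_def)
  also have "\<dots> \<le> \<bar>inverse h\<bar> * orbit_norm x"
    by (rule orbit_norm_scaleR_le)
  finally show ?thesis using assms by (simp add: field_simps)
qed

lemma norm_V_power_le:
  assumes "0 < h"
  shows "norm ((V h ^^ n) x) \<le> M * norm x"
proof -
  have "orbit_norm ((V h ^^ n) x) \<le> orbit_norm x"
    by (induction n) (auto intro: order_trans[OF orbit_norm_V_le[OF assms]])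
  then show ?thesis
    using norm_le_orbit_norm[of "(V h ^^ n) x"] orbit_norm_le[of x] by linarith
qed

lemma bounded_clinear_V_power:
  assumes "0 < h"
  shows "bounded_clinear (V h ^^ n)"
proof -
  have "(V h ^^ n) (x + y) = (V h ^^ n) x + (V h ^^ n) y" for x y
    by (induction n) (simp_all add: V_add assms)
  moreover have "(V h ^^ n) (c *\<^sub>C x) = c *\<^sub>C (V h ^^ n) x" for c x
    by (induction n) (simp_all add: V_scaleC assms)
  ultimately show ?thesis
    unfolding bounded_clinear_def clinear_on_def using norm_V_power_le[OF assms] by blast
qed

lemmas bounded_linear_V_power =
  bounded_clinear_imp_bounded_linear[OF bounded_clinear_V_power]

lemma bounded_linear_V: "0 < h \<Longrightarrow> bounded_linear (V h)"
  using bounded_linear_V_power[of h 1] by simp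

lemma T_V_power:
  assumes "0 < h" "0 \<le> t"
  shows "T t ((V h ^^ n) x) = (V h ^^ n) (T t x)"
proof (induction n)
  case (Suc n)
  have "T t (V h y) = V h (T t y)" for y
    unfolding V_def using assms by (simp add: T_resolvent T_scaleR)
  then show ?case using Suc by simp
qed simp

lemma domain_dense:
  assumes "0 < e"
  shows "\<exists>y\<in>D. norm (y - x) < e"
proof -
  have "\<forall>\<^sub>F h in at_right 0. dist (orbit_integral h x /\<^sub>R h) x < e"
    using orbit_mean_tendsto assms by (rule tendstoD)
  moreover have "\<forall>\<^sub>F h in at_right 0. orbit_integral h x /\<^sub>R h \<in> D"
    using eventually_at_right_less[of "0::real"]
    by eventually_elim (auto intro!: generator_scaleR(1) domainI[OF generator_orbit_integral])
  ultimately have "\<forall>\<^sub>F h in at_right (0::real). \<exists>y\<in>D. norm (y - x) < e"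
    by eventually_elim (auto simp: dist_norm)
  then show ?thesis by simp
qed

text \<open>The density argument by which strong limits of uniformly bounded operators are reduced to the
  domain, where the generator gives rates of convergence.\<close>

lemma tendsto_from_domain:
  assumes lin: "\<forall>\<^sub>F i in F. bounded_linear (f i) \<and> (\<forall>x. norm (f i x) \<le> c * norm x)"
    and g: "bounded_linear g"
    and D: "\<And>y. y \<in> D \<Longrightarrow> ((\<lambda>i. f i y) \<longlongrightarrow> g y) F"
  shows "((\<lambda>i. f i x) \<longlongrightarrow> g x) F"
proof (rule tendstoI)
  fix e :: real assume e: "0 < e"
  interpret g: bounded_linear g by fact
  obtain k where k: "0 < k" "\<And>x. norm (g x) \<le> norm x * k" using g.pos_bounded by blast
  define b where "b = \<bar>c\<bar> + k"
  have "0 < b" using k by (simp add: b_def)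
  then obtain y where y: "y \<in> D" "norm (y - x) < e / (2 * b)"
    using domain_dense[of "e / (2 * b)" x] e by auto
  have "\<forall>\<^sub>F i in F. dist (f i y) (g y) < e / 2"
    using D[OF y(1)] e by (intro tendstoD) auto
  with lin show "\<forall>\<^sub>F i in F. dist (f i x) (g x) < e"
  proof eventually_elim
    case (elim i)
    interpret f: bounded_linear "f i" using elim by simp
    have "norm (f i x - g x) = norm ((f i y - g y) - f i (y - x) + g (y - x))"
      by (simp add: f.diff g.diff)
    also have "\<dots> \<le> norm (f i y - g y) + norm (f i (y - x)) + norm (g (y - x))"
      by (meson add_right_mono norm_triangle_ineq norm_triangle_ineq4 order_trans)
    also have "\<dots> \<le> norm (f i y - g y) + b * norm (y - x)"
    proof -
      have "norm (f i (y - x)) \<le> \<bar>c\<bar> * norm (y - x)"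
        using elim by (meson abs_ge_self mult_right_mono norm_ge_zero order_trans)
      moreover have "norm (g (y - x)) \<le> k * norm (y - x)"
        using k(2)[of "y - x"] by (simp add: mult.commute)
      ultimately show ?thesis by (simp add: b_def distrib_right)
    qed
    also have "\<dots> < e / 2 + e / 2"
      using elim y(2) \<open>0 < b\<close> by (intro add_strict_mono) (simp_all add: dist_norm field_simps)
    finally show ?case by (simp add: dist_norm)
  qed
qed

lemma V_on_domain:
  assumes "0 < h" "x \<in> D"
  shows "V h x = x - h *\<^sub>R V h (A x)"
proof -
  interpret V: bounded_linear "V h" by (rule bounded_linear_V) fact
  have "V h (x + h *\<^sub>R A x) = x" by (rule V_eqI) (use assms in simp_all)
  then show ?thesis by (simp add: V.add V.scaleR algebra_simps)
qed

lemma V_tendsto: "((\<lambda>h. V h x) \<longlongrightarrow> x) (at_right 0)"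
proof (rule tendsto_from_domain[where g = "\<lambda>x. x" and c = M])
  show "\<forall>\<^sub>F h in at_right 0. bounded_linear (V h) \<and> (\<forall>x. norm (V h x) \<le> M * norm x)"
    using eventually_at_right_less[of "0::real"]
    by eventually_elim (auto intro: bounded_linear_V norm_V_power_le[of _ 1, simplified])
next
  fix y assume y: "y \<in> D"
  have "((\<lambda>h. V h y - y) \<longlongrightarrow> 0) (at_right 0)"
  proof (rule Lim_null_comparison)
    show "\<forall>\<^sub>F h in at_right 0. norm (V h y - y) \<le> h * (M * norm (A y))"
      using eventually_at_right_less[of "0::real"]
    proof eventually_elim
      case (elim h)
      then show ?case
        using norm_V_power_le[of h 1 "A y"] y by (simp add: V_on_domain mult_left_mono)
    qed
    have "((\<lambda>h. h * (M * norm (A y))) \<longlongrightarrow> 0 * (M * norm (A y))) (at_right 0)"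
      by (intro tendsto_intros)
    then show "((\<lambda>h. h * (M * norm (A y))) \<longlongrightarrow> 0) (at_right 0)" by simp
  qed
  then show "((\<lambda>h. V h y) \<longlongrightarrow> y) (at_right 0)" by (rule LIM_zero_cancel)
qed (rule bounded_linear_ident)

text \<open>The telescoping estimate for the \<open>n\<close>-th powers of two commuting, power-bounded operators.
  The factor \<open>T s\<close> is there for the induction: the bound \<open>M\<close> must be used once for the whole
  product of semigroup operators, not once for each factor.\<close>

lemma euler_error:
  assumes "0 < h" "0 \<le> s"
  shows "norm (T s ((V h ^^ n) x - T (n * h) x)) \<le> n * (M * (M * norm (V h x - T h x)))"
  using \<open>0 \<le> s\<close>
proof (induction n arbitrary: s)
  case 0
  then show ?case by (simp add: T_zero T_null)
next
  case (Suc n)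
  interpret V: bounded_linear "V h ^^ n" by (rule bounded_linear_V_power) fact
  have "T (Suc n * h) x = T h (T (n * h) x)"
    using T_plus[of h "n * h" x] assms by (simp add: algebra_simps)
  moreover have "(V h ^^ Suc n) x = (V h ^^ n) (V h x)"
    by (simp add: funpow_swap1)
  ultimately have "(V h ^^ Suc n) x - T (Suc n * h) x
      = (V h ^^ n) (V h x - T h x) + T h ((V h ^^ n) x - T (n * h) x)"
    using assms by (simp add: V.diff T_diff T_V_power)
  then have "T s ((V h ^^ Suc n) x - T (Suc n * h) x)
      = T s ((V h ^^ n) (V h x - T h x)) + T (s + h) ((V h ^^ n) x - T (n * h) x)"
    using assms Suc.prems by (simp only: T_add T_plus less_imp_le)
  also have "norm \<dots> \<le> M * (M * norm (V h x - T h x)) + n * (M * (M * norm (V h x - T h x)))"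
  proof (rule norm_triangle_le, rule add_mono)
    have "norm (T s ((V h ^^ n) (V h x - T h x))) \<le> M * norm ((V h ^^ n) (V h x - T h x))"
      using Suc.prems by (rule norm_T_le)
    also have "\<dots> \<le> M * (M * norm (V h x - T h x))"
      using M_ge_1 assms by (intro mult_left_mono norm_V_power_le) auto
    finally show "norm (T s ((V h ^^ n) (V h x - T h x))) \<le> M * (M * norm (V h x - T h x))" .
    show "norm (T (s + h) ((V h ^^ n) x - T (n * h) x)) \<le> n * (M * (M * norm (V h x - T h x)))"
      using Suc.prems assms by (intro Suc.IH) simp
  qed
  finally show ?case by (simp add: algebra_simps)
qed

text \<open>On the domain, the local error \<open>V\<^sub>h y - T(h)y\<close> is \<open>o(h)\<close>, since both operators have the
  derivative \<open>-A\<close> at \<open>h = 0\<close>.  The \<open>n = t/h\<close> steps together thus contribute \<open>o(1)\<close>.\<close>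

lemma euler_formula:
  assumes t: "0 < t"
  shows "(\<lambda>n. (V (t / n) ^^ n) x) \<longlonglongrightarrow> T t x"
proof (rule tendsto_from_domain[where g = "T t" and c = M])
  show "\<forall>\<^sub>F n in sequentially. bounded_linear (V (t / real n) ^^ n) \<and>
      (\<forall>x. norm ((V (t / real n) ^^ n) x) \<le> M * norm x)"
    using eventually_gt_at_top[of 0]
    by eventually_elim (use t in \<open>auto intro: bounded_linear_V_power norm_V_power_le\<close>)
  show "bounded_linear (T t)" using t by (intro bounded_linear_T) simp
next
  fix y assume y: "y \<in> D"
  have "((\<lambda>h. - V h (A y) - (T h y - y) /\<^sub>R h) \<longlongrightarrow> - A y - (- A y)) (at_right 0)"
    by (intro tendsto_intros V_tendsto generator_tendsto y)
  then have "((\<lambda>h. t * (M * (M * norm (- V h (A y) - (T h y - y) /\<^sub>R h))))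
      \<longlongrightarrow> t * (M * (M * norm (- A y - (- A y))))) (at_right 0)"
    by (intro tendsto_mult[OF tendsto_const] tendsto_norm)
  moreover have "filterlim (\<lambda>n. t / real n) (at_right 0) sequentially"
    unfolding filterlim_at
  proof
    show "(\<lambda>n. t / real n) \<longlonglongrightarrow> 0" by (rule lim_const_over_n)
    show "\<forall>\<^sub>F n in sequentially. t / real n \<in> {0<..} \<and> t / real n \<noteq> 0"
      using eventually_gt_at_top[of 0] by eventually_elim (use t in auto)
  qed
  ultimately have lim: "((\<lambda>n. t * (M * (M * norm (- V (t / real n) (A y)
      - (T (t / real n) y - y) /\<^sub>R (t / real n))))) \<longlongrightarrow> 0) sequentially"
    by (auto dest: filterlim_compose)
  have "((\<lambda>n. (V (t / real n) ^^ n) y - T t y) \<longlongrightarrow> 0) sequentially"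
  proof (rule Lim_null_comparison[OF _ lim])
    show "\<forall>\<^sub>F n in sequentially. norm ((V (t / real n) ^^ n) y - T t y) \<le>
        t * (M * (M * norm (- V (t / real n) (A y) - (T (t / real n) y - y) /\<^sub>R (t / real n))))"
      using eventually_gt_at_top[of 0]
    proof eventually_elim
      case (elim n)
      define h where "h = t / n"
      have h: "0 < h" "n * h = t" using elim t by (simp_all add: h_def)
      have "V h y - T h y = h *\<^sub>R (- V h (A y) - (T h y - y) /\<^sub>R h)"
        using V_on_domain[OF h(1) y] h(1) by (simp add: algebra_simps)
      then have "norm (V h y - T h y) = h * norm (- V h (A y) - (T h y - y) /\<^sub>R h)"
        using h by simp
      then have eq: "n * (M * (M * norm (V h y - T h y)))
          = (n * h) * (M * (M * norm (- V h (A y) - (T h y - y) /\<^sub>R h)))"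
        by (simp only: mult_ac)
      have "norm ((V h ^^ n) y - T t y) \<le> n * (M * (M * norm (V h y - T h y)))"
        using euler_error[OF h(1), of 0 n y] by (simp add: T_zero h(2))
      then show ?case
        unfolding eq h(2) by (simp only: h_def)
    qed
  qed
  then show "(\<lambda>n. (V (t / n) ^^ n) y) \<longlonglongrightarrow> T t y" by (rule LIM_zero_cancel)
qed

end

section \<open>Operators with bounded resolvent products\<close>

locale commuting_operator = semigroup_generator +
  fixes B :: "'a \<Rightarrow> 'a" and C K :: real
  assumes clinear_B: "clinear_on D B"
    and norm_B_le: "x \<in> D \<Longrightarrow> norm (B x) \<le> C * (norm x + norm (A x))"
    and T_B: "0 \<le> t \<Longrightarrow> x \<in> D \<Longrightarrow> T t (B x) = B (T t x)"
    and norm_B_resolvent_le: "0 < Re l \<Longrightarrow> norm (B (R l x)) \<le> K * norm x"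
    and K_nonneg: "0 \<le> K"
begin

lemma B_add: "x \<in> D \<Longrightarrow> y \<in> D \<Longrightarrow> B (x + y) = B x + B y"
  and B_scaleC: "x \<in> D \<Longrightarrow> B (c *\<^sub>C x) = c *\<^sub>C B x"
  using clinear_B by (simp_all add: clinear_on_def)

lemma B_scaleR: "x \<in> D \<Longrightarrow> B (r *\<^sub>R x) = r *\<^sub>R B x"
  by (metis B_scaleC scaleC_complex_of_real)

lemma B_diff:
  assumes "x \<in> D" "y \<in> D"
  shows "B (x - y) = B x - B y"
  using B_add[OF assms(1) generator_scaleC(1)[OF assms(2), of "-1"]]
    B_scaleC[OF assms(2), of "-1"]
  by (simp add: scaleC.minus_left scaleC_one)

text \<open>If \<open>y\<close> and \<open>Ay\<close> are in the domain, then the difference quotients of the orbit of \<open>y\<close>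
  converge in the graph norm, so that \<open>B\<close> may be applied to their limit.\<close>

lemma B_generator:
  assumes y: "y \<in> D" "A y \<in> D"
  shows "B y \<in> D" "A (B y) = B (A y)"
proof -
  define d where "d h = (T h y - y) /\<^sub>R h + A y" for h
  have d_D: "d h \<in> D" if "0 < h" for h
    unfolding d_def using that y by (auto intro!: generator_add generator_scaleR generator_diff generator_T)
  have A_d: "A (d h) = (T h (A y) - A y) /\<^sub>R h + A (A y)" if "0 < h" for h
    unfolding d_def using that y
    by (simp add: generator_add generator_scaleR generator_diff generator_T)
  have lim_d: "(d \<longlongrightarrow> - A y + A y) (at_right 0)"
    unfolding d_def by (intro tendsto_intros generator_tendsto y)
  have lim_Ad: "((\<lambda>h. (T h (A y) - A y) /\<^sub>R h + A (A y)) \<longlongrightarrow> - A (A y) + A (A y)) (at_right 0)"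
    by (intro tendsto_intros generator_tendsto y)
  have lim: "((\<lambda>h. C * (norm (d h) + norm ((T h (A y) - A y) /\<^sub>R h + A (A y))))
      \<longlongrightarrow> C * (norm (- A y + A y) + norm (- A (A y) + A (A y)))) (at_right 0)"
    by (rule tendsto_mult[OF tendsto_const tendsto_add[OF tendsto_norm[OF lim_d] tendsto_norm[OF lim_Ad]]])
  have "((\<lambda>h. B (d h)) \<longlongrightarrow> 0) (at_right 0)"
  proof (rule Lim_null_comparison)
    show "\<forall>\<^sub>F h in at_right 0. norm (B (d h)) \<le> C * (norm (d h) + norm ((T h (A y) - A y) /\<^sub>R h + A (A y)))"
      using eventually_at_right_less[of "0::real"]
      by eventually_elim (metis norm_B_le d_D A_d)
  qed (use lim in simp)
  then have "((\<lambda>h. B (d h) - B (A y)) \<longlongrightarrow> 0 - B (A y)) (at_right 0)"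
    by (intro tendsto_intros)
  moreover have "\<forall>\<^sub>F h in at_right 0. B (d h) - B (A y) = (T h (B y) - B y) /\<^sub>R h"
    using eventually_at_right_less[of "0::real"]
  proof eventually_elim
    case (elim h)
    then show ?case unfolding d_def using y
      by (simp add: B_add B_scaleR B_diff T_B generator_scaleR generator_diff generator_T)
  qed
  ultimately have *: "((\<lambda>h. (T h (B y) - B y) /\<^sub>R h) \<longlongrightarrow> 0 - B (A y)) (at_right 0)"
    by (rule Lim_transform_eventually)
  show "B y \<in> D" "A (B y) = B (A y)"
    using domainI[OF *] generatorI[OF *] by simp_all
qed

text \<open>If \<open>y = V\<^sub>h x\<close>, then \<open>hAy = x - y\<close> is in the domain together with \<open>x\<close>, so \<open>B\<close> commutes with
  \<open>1 + hA\<close> at \<open>y\<close>.\<close>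

lemma B_V:
  assumes h: "0 < h" and x: "x \<in> D"
  shows "B (V h x) = V h (B x)"
proof (rule V_eqI[symmetric, OF h])
  define y where "y = V h x"
  have y: "y \<in> D" unfolding y_def by (rule V_in_domain[OF h])
  have eq: "y + h *\<^sub>R A y = x" unfolding y_def by (rule V_right[OF h])
  then have "h *\<^sub>R A y = x - y" by (simp add: algebra_simps)
  then have "A y = (x - y) /\<^sub>R h" using h by (metis less_irrefl scaleR_left_imp_eq scaleR_scaleR right_inverse scaleR_one)
  then have Ay: "A y \<in> D" using x y by (simp add: generator_scaleR generator_diff)
  show "B (V h x) \<in> D" using B_generator(1)[OF y Ay] by (simp add: y_def)
  have "B y + h *\<^sub>R A (B y) = B (y + h *\<^sub>R A y)"
    using y Ay by (simp add: B_generator(2) B_add B_scaleR generator_scaleR)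
  then show "B (V h x) + h *\<^sub>R A (B (V h x)) = B x"
    by (simp add: eq) (simp add: y_def)
qed

lemma B_V_power:
  assumes "0 < h" "x \<in> D"
  shows "(V h ^^ n) x \<in> D \<and> B ((V h ^^ n) x) = (V h ^^ n) (B x)"
  by (induction n) (use assms V_in_domain B_V in auto)

text \<open>A discrete maximal regularity estimate: \<open>hBVu\<close> is controlled by the residual
  \<open>u\<^sub>m - Vu\<^sub>m\<^sub>-\<^sub>1\<close>.  In terms of generating functions the residual of \<open>P(z)\<close> is
  \<open>F(z) = (1 - zV)P(z)\<close>, and \<open>hV(1 - zV)\<^sup>-\<^sup>1 = ((1 - z)/h + A)\<^sup>-\<^sup>1\<close>.  The latter is the resolvent at a
  point of the right half-plane if \<open>\<bar>z\<bar> < 1\<close>, hence \<open>\<parallel>hBVP(z)\<parallel> \<le> K\<parallel>F(z)\<parallel>\<close> there.  Parseval's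
  identity on the circles \<open>\<bar>z\<bar> = r\<close> and \<open>r \<rightarrow> 1\<close> turn this into an estimate for the
  coefficients; here the Hilbert space structure is essential.\<close>

lemma discrete_maximal_regularity:
  fixes u :: "nat \<Rightarrow> 'a"
  assumes h: "0 < h" and uN: "u N = 0"
  defines "f \<equiv> \<lambda>m. u m - (if m = 0 then 0 else V h (u (m - 1)))"
  shows "(\<Sum>m<Suc N. (norm (h *\<^sub>R B (V h (u m))))\<^sup>2) \<le> K\<^sup>2 * (\<Sum>m<Suc N. (norm (f m))\<^sup>2)"
proof -
  define G where "G x = h *\<^sub>R B (V h x)" for x
  interpret V: bounded_linear "V h" by (rule bounded_linear_V) fact
  have G_zero: "G 0 = 0"
    using B_scaleR[OF V_in_domain[OF h], of 0 0] by (simp add: G_def V.zero)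
  have G_add: "G (x + y) = G x + G y" for x y
    by (simp add: G_def V.add B_add V_in_domain h scaleR_add_right)
  have G_scaleC: "G (c *\<^sub>C x) = c *\<^sub>C G x" for c x
    by (simp add: G_def V_scaleC B_scaleC V_in_domain h scaleC_scaleR)
  have G_sum: "G (\<Sum>m\<in>I. c m *\<^sub>C x m) = (\<Sum>m\<in>I. c m *\<^sub>C G (x m))" for c x and I :: "nat set"
    by (induction I rule: infinite_finite_induct) (simp_all add: G_zero G_add G_scaleC)
  have V_sum: "V h (\<Sum>m\<in>I. c m *\<^sub>C x m) = (\<Sum>m\<in>I. c m *\<^sub>C V h (x m))" for c x and I :: "nat set"
    by (simp add: V.sum V_scaleC h)
  have pointwise: "norm (\<Sum>m<Suc N. z ^ m *\<^sub>C G (u m)) \<le> K * norm (\<Sum>m<Suc N. z ^ m *\<^sub>C f m)"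
    if z: "cmod z < 1" for z
  proof -
    define P where "P = (\<Sum>m<Suc N. z ^ m *\<^sub>C u m)"
    define Q where "Q = V h P"
    have "(\<Sum>m<Suc N. z ^ m *\<^sub>C (if m = 0 then 0 else V h (u (m - 1))))
        = (\<Sum>m<N. z ^ Suc m *\<^sub>C V h (u m))"
      by (subst sum.lessThan_Suc_shift) (simp add: scaleC.zero_right)
    also have "\<dots> = (\<Sum>m<Suc N. z ^ Suc m *\<^sub>C V h (u m))"
      by (simp only: sum.lessThan_Suc) (simp add: uN V.zero scaleC.zero_right)
    also have "\<dots> = z *\<^sub>C Q"
      by (simp only: Q_def P_def V_sum scaleC.sum_right scaleC_scaleC power_Suc)
    finally have shift: "(\<Sum>m<Suc N. z ^ m *\<^sub>C (if m = 0 then 0 else V h (u (m - 1)))) = z *\<^sub>C Q" .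
    have F: "(\<Sum>m<Suc N. z ^ m *\<^sub>C f m) = P - z *\<^sub>C Q"
      by (simp only: f_def P_def scaleC.diff_right sum_subtractf shift)
    have Q: "Q \<in> D" "Q + h *\<^sub>R A Q = P"
      unfolding Q_def by (rule V_in_domain[OF h], rule V_right[OF h])
    have l: "0 < Re ((1 - z) / complex_of_real h)"
      using z h complex_Re_le_cmod[of z] by (simp add: Re_divide_of_real)
    have "R ((1 - z) / complex_of_real h) (P - z *\<^sub>C Q) = h *\<^sub>R Q"
    proof (rule resolvent_eqI[OF l])
      have "((1 - z) / complex_of_real h) *\<^sub>C (h *\<^sub>R Q) = (1 - z) *\<^sub>C Q"
        using h by (simp add: scaleC_scaleC flip: scaleC_complex_of_real)
      then show "((1 - z) / complex_of_real h) *\<^sub>C (h *\<^sub>R Q) + A (h *\<^sub>R Q) = P - z *\<^sub>C Q"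
        unfolding generator_scaleR(2)[OF Q(1)] Q(2)[symmetric]
        by (simp add: scaleC.diff_left scaleC_one)
    qed (use Q generator_scaleR in auto)
    then have "norm (B (h *\<^sub>R Q)) \<le> K * norm (P - z *\<^sub>C Q)"
      using norm_B_resolvent_le[OF l, of "P - z *\<^sub>C Q"] by simp
    moreover have "B (h *\<^sub>R Q) = G P" using Q by (simp add: B_scaleR G_def Q_def)
    moreover have "G P = (\<Sum>m<Suc N. z ^ m *\<^sub>C G (u m))" unfolding P_def by (rule G_sum)
    ultimately show ?thesis unfolding F by simp
  qed
  have circle: "(\<Sum>m<Suc N. (r ^ m * norm (G (u m)))\<^sup>2) \<le> K\<^sup>2 * (\<Sum>m<Suc N. (r ^ m * norm (f m))\<^sup>2)"
    if r: "0 < r" "r < 1" for r :: real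
  proof -
    define \<zeta> where "\<zeta> k = cis (2 * pi / Suc N) ^ k" for k
    have polar: "\<zeta> k ^ m *\<^sub>C (r ^ m *\<^sub>R x) = (complex_of_real r * \<zeta> k) ^ m *\<^sub>C x" for k m and x :: 'a
      by (simp add: power_mult_distrib scaleC_scaleC mult.commute flip: scaleC_complex_of_real)
    have parseval: "Suc N * (\<Sum>m<Suc N. (r ^ m * norm (x m))\<^sup>2)
        = (\<Sum>k<Suc N. (norm (\<Sum>m<Suc N. (complex_of_real r * \<zeta> k) ^ m *\<^sub>C x m))\<^sup>2)" for x :: "nat \<Rightarrow> 'a"
      using discrete_parseval[of "Suc N" "\<lambda>m. r ^ m *\<^sub>R x m"] r
      unfolding \<zeta>_def[symmetric] polar by simp
    have "Suc N * (\<Sum>m<Suc N. (r ^ m * norm (G (u m)))\<^sup>2)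
        \<le> (\<Sum>k<Suc N. K\<^sup>2 * (norm (\<Sum>m<Suc N. (complex_of_real r * \<zeta> k) ^ m *\<^sub>C f m))\<^sup>2)"
      unfolding parseval power_mult_distrib[symmetric]
      by (intro sum_mono power_mono pointwise)
        (use r in \<open>simp_all add: norm_mult \<zeta>_def norm_power\<close>)
    also have "\<dots> = Suc N * (K\<^sup>2 * (\<Sum>m<Suc N. (r ^ m * norm (f m))\<^sup>2))"
      unfolding sum_distrib_left[symmetric] parseval[symmetric] by (rule mult.left_commute)
    finally show ?thesis
      using mult_le_cancel_left_pos[of "real (Suc N)"] by simp
  qed
  have lim: "((\<lambda>r::real. \<Sum>m<Suc N. (r ^ m * a m)\<^sup>2) \<longlongrightarrow> (\<Sum>m<Suc N. (1 ^ m * a m)\<^sup>2)) (at_left 1)"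
    for a :: "nat \<Rightarrow> real"
    by (intro tendsto_intros)
  have "(\<Sum>m<Suc N. (1 ^ m * norm (G (u m)))\<^sup>2) \<le> K\<^sup>2 * (\<Sum>m<Suc N. (1 ^ m * norm (f m))\<^sup>2)"
  proof (rule tendsto_le[OF _ tendsto_mult[OF tendsto_const lim] lim])
    show "\<forall>\<^sub>F r in at_left 1. (\<Sum>m<Suc N. (r ^ m * norm (G (u m)))\<^sup>2)
        \<le> K\<^sup>2 * (\<Sum>m<Suc N. (r ^ m * norm (f m))\<^sup>2)"
      by (intro eventually_at_leftI[of 0] circle) auto
  qed simp
  then show ?thesis by (simp add: G_def)
qed

text \<open>The residual of the tent-shaped sequence \<open>u\<^sub>m = c\<^sub>m V\<^sup>m x\<close>, where \<open>c\<close> increases from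
  \<open>0\<close> to \<open>n\<close> with slope one and then decreases to \<open>0\<close>, consists of the bounded vectors
  \<open>\<plusminus>V\<^sup>m x\<close>.  So \<open>h\<^sup>2 (\<Sum>m\<le>n. m\<^sup>2 \<parallel>BV\<^sup>m\<^sup>+\<^sup>1 x\<parallel>\<^sup>2)\<close> is of order \<open>n\<close>.  Up to the factor \<open>M\<close>, each norm in this
  sum is at least \<open>\<parallel>BV\<^sup>n\<^sup>+\<^sup>1 x\<parallel>\<close>, and the sum of the weights is of order \<open>n\<^sup>3\<close>.\<close>

lemma norm_B_V_power_le:
  assumes h: "0 < h" and n: "0 < n"
  shows "norm (B ((V h ^^ Suc n) x)) \<le> 3 * K * M\<^sup>2 / (n * h) * norm x"
proof -
  define c :: "nat \<Rightarrow> nat" where "c m = (if m \<le> n then m else 2 * n - m)" for m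
  define u where "u m = real (c m) *\<^sub>R (V h ^^ m) x" for m
  define f where "f m = u m - (if m = 0 then 0 else V h (u (m - 1)))" for m
  define b where "b = norm (B ((V h ^^ Suc n) x))"
  interpret V: bounded_linear "V h" by (rule bounded_linear_V) fact
  have f: "norm (f m) \<le> M * norm x" for m
  proof (cases m)
    case 0
    then show ?thesis using M_ge_1 by (simp add: f_def u_def c_def)
  next
    case (Suc k)
    have "f m = (real (c (Suc k)) - real (c k)) *\<^sub>R (V h ^^ Suc k) x"
      by (simp add: f_def u_def Suc V.scaleR scaleR_diff_left)
    moreover have "\<bar>real (c (Suc k)) - real (c k)\<bar> \<le> 1"
      by (auto simp: c_def)
    ultimately have "norm (f m) \<le> 1 * norm ((V h ^^ Suc k) x)"
      by (metis norm_scaleR mult_right_mono norm_ge_zero)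
    then show ?thesis using norm_V_power_le[OF h, of "Suc k" x] by linarith
  qed
  have step: "real m ^ 2 * (h * b)\<^sup>2 \<le> M\<^sup>2 * (norm (h *\<^sub>R B (V h (u m))))\<^sup>2" if "m \<le> n" for m
  proof -
    have D: "(V h ^^ Suc m) x \<in> D" using V_in_domain[OF h] by simp
    have "(V h ^^ Suc n) x = (V h ^^ (n - m)) ((V h ^^ Suc m) x)"
      using that by (metis Suc_diff_le add.commute comp_apply funpow_add le_add_diff_inverse add_Suc_right)
    then have "b = norm ((V h ^^ (n - m)) (B ((V h ^^ Suc m) x)))"
      unfolding b_def using B_V_power[OF h D] by simp
    also have "\<dots> \<le> M * norm (B ((V h ^^ Suc m) x))"
      by (rule norm_V_power_le[OF h])
    finally have "m * (h * b) \<le> m * (h * (M * norm (B ((V h ^^ Suc m) x))))"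
      using h by (intro mult_left_mono) auto
    also have "\<dots> = M * norm (h *\<^sub>R B (V h (u m)))"
      using that h D by (simp add: u_def c_def V.scaleR B_scaleR)
    finally have "(m * (h * b))\<^sup>2 \<le> (M * norm (h *\<^sub>R B (V h (u m))))\<^sup>2"
      using h by (intro power_mono) (simp_all add: b_def)
    then show ?thesis by (simp only: power_mult_distrib)
  qed
  have sum_squares: "real n ^ 3 \<le> 3 * (\<Sum>m\<le>n. real m ^ 2)" for n
    by (induction n) (simp_all add: power2_eq_square power3_eq_cube algebra_simps)
  have "real n ^ 3 * (h * b)\<^sup>2 \<le> 3 * (\<Sum>m\<le>n. real m ^ 2) * (h * b)\<^sup>2"
    by (intro mult_right_mono sum_squares) simp
  also have "\<dots> = 3 * (\<Sum>m\<le>n. real m ^ 2 * (h * b)\<^sup>2)"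
    by (simp add: sum_distrib_right)
  also have "\<dots> \<le> 3 * (\<Sum>m\<le>n. M\<^sup>2 * (norm (h *\<^sub>R B (V h (u m))))\<^sup>2)"
    using step by (intro mult_left_mono sum_mono) auto
  also have "\<dots> \<le> 3 * (\<Sum>m<Suc (2 * n). M\<^sup>2 * (norm (h *\<^sub>R B (V h (u m))))\<^sup>2)"
    by (intro mult_left_mono sum_mono2) auto
  also have "\<dots> = 3 * (M\<^sup>2 * (\<Sum>m<Suc (2 * n). (norm (h *\<^sub>R B (V h (u m))))\<^sup>2))"
    by (simp only: sum_distrib_left)
  also have "\<dots> \<le> 3 * (M\<^sup>2 * (K\<^sup>2 * (\<Sum>m<Suc (2 * n). (norm (f m))\<^sup>2)))"
    unfolding f_def using n
    by (intro mult_left_mono discrete_maximal_regularity h) (simp_all add: u_def c_def)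
  also have "\<dots> \<le> 3 * (M\<^sup>2 * (K\<^sup>2 * (\<Sum>m<Suc (2 * n). (M * norm x)\<^sup>2)))"
    using f by (intro mult_left_mono sum_mono power_mono) auto
  also have "\<dots> = 3 * (M\<^sup>2 * (K\<^sup>2 * ((2 * n + 1) * (M * norm x)\<^sup>2)))"
    by simp
  also have "\<dots> \<le> 3 * (M\<^sup>2 * (K\<^sup>2 * ((3 * n) * (M * norm x)\<^sup>2)))"
    using n by (intro mult_left_mono mult_right_mono) auto
  also have "\<dots> = n * (3 * K * M\<^sup>2 * norm x)\<^sup>2"
    by (simp add: power2_eq_square)
  finally have "n * (n * h * b)\<^sup>2 \<le> n * (3 * K * M\<^sup>2 * norm x)\<^sup>2"
    by (simp add: power2_eq_square power3_eq_cube mult_ac)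
  then have "(n * h * b)\<^sup>2 \<le> (3 * K * M\<^sup>2 * norm x)\<^sup>2"
    using n by simp
  then have "n * h * b \<le> 3 * K * M\<^sup>2 * norm x"
    by (rule power2_le_imp_le) (simp add: K_nonneg)
  then show ?thesis using n h by (simp add: b_def field_simps)
qed

lemma norm_T_B_le:
  assumes t: "0 < t" and x: "x \<in> D"
  shows "norm (T t (B x)) \<le> 6 * K * M\<^sup>2 / t * norm x"
proof (rule tendsto_upperbound)
  show "(\<lambda>n. norm ((V (t / Suc n) ^^ Suc n) (B x))) \<longlonglongrightarrow> norm (T t (B x))"
    using tendsto_norm[OF LIMSEQ_Suc[OF euler_formula[OF t, of "B x"]]] .
  show "\<forall>\<^sub>F n in sequentially. norm ((V (t / Suc n) ^^ Suc n) (B x)) \<le> 6 * K * M\<^sup>2 / t * norm x"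
    using eventually_gt_at_top[of 0]
  proof eventually_elim
    case (elim n)
    define h where "h = t / Suc n"
    have h: "0 < h" using t by (simp add: h_def)
    \<comment> \<open>There are \<open>n + 1\<close> steps of length \<open>h\<close>, but the estimate counts only \<open>n\<close>.\<close>
    have "t / 2 \<le> n * h" using t elim by (simp add: h_def field_simps)
    then have "3 * K * M\<^sup>2 / (n * h) \<le> 3 * K * M\<^sup>2 / (t / 2)"
      using t K_nonneg by (intro divide_left_mono) (simp_all add: elim h)
    then have "3 * K * M\<^sup>2 / (n * h) * norm x \<le> 3 * K * M\<^sup>2 / (t / 2) * norm x"
      by (rule mult_right_mono) simp
    then show ?case
      using norm_B_V_power_le[OF h elim, of x] B_V_power[OF h x, of "Suc n"]
      unfolding h_def[symmetric] by simp
  qed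
qed simp

text \<open>On all of \<open>X\<close> the extension of \<open>T(t)B\<close> is the limit of the operators \<open>T(t)BV\<^sub>h\<close>
  as \<open>h \<rightarrow> 0\<close>.\<close>

lemma T_B_extension:
  assumes t: "0 < t"
  shows "\<exists>S. bounded_clinear S \<and> (\<forall>x\<in>D. S x = T t (B x)) \<and> onorm S \<le> 6 * K * M\<^sup>2 / t"
proof -
  define c where "c = 6 * K * M\<^sup>2 / t"
  define v where "v n x = V (inverse (Suc n)) x" for n x
  define S where "S x = lim (\<lambda>n. T t (B (v n x)))" for x
  have "filterlim (\<lambda>n. inverse (real (Suc n))) (at_right 0) sequentially"
    unfolding filterlim_at using LIMSEQ_inverse_real_of_nat by auto
  from filterlim_compose[OF V_tendsto this] have v: "(\<lambda>n. v n x) \<longlonglongrightarrow> x" for x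
    by (simp add: v_def)
  have v_D: "v n x \<in> D" for n x
    unfolding v_def by (rule V_in_domain) simp
  have diff: "norm (T t (B x) - T t (B y)) \<le> c * norm (x - y)" if "x \<in> D" "y \<in> D" for x y
    using norm_T_B_le[OF t generator_diff(1)[OF that]] that t by (simp add: c_def B_diff T_diff)
  have c: "0 \<le> c" using t K_nonneg by (simp add: c_def)
  have S: "(\<lambda>n. T t (B (v n x))) \<longlonglongrightarrow> S x" for x
  proof -
    have "Cauchy (\<lambda>n. T t (B (v n x)))"
      unfolding Cauchy_def
    proof (intro allI impI)
      fix e :: real assume "0 < e"
      \<comment> \<open>Adding one keeps the denominator positive if \<open>K = 0\<close>.\<close>
      then have "0 < e / (c + 1)" using c by simp
      then obtain N where N: "\<And>m n. N \<le> m \<Longrightarrow> N \<le> n \<Longrightarrow> dist (v m x) (v n x) < e / (c + 1)"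
        using LIMSEQ_imp_Cauchy[OF v[of x]] unfolding Cauchy_def by blast
      have "dist (T t (B (v m x))) (T t (B (v n x))) < e" if "N \<le> m" "N \<le> n" for m n
      proof -
        have "dist (T t (B (v m x))) (T t (B (v n x))) \<le> c * dist (v m x) (v n x)"
          unfolding dist_norm by (rule diff[OF v_D v_D])
        also have "\<dots> \<le> (c + 1) * dist (v m x) (v n x)"
          by (simp add: mult_right_mono)
        also have "\<dots> < e"
          using N[OF that] c by (simp add: field_simps)
        finally show ?thesis .
      qed
      then show "\<exists>N. \<forall>m\<ge>N. \<forall>n\<ge>N. dist (T t (B (v m x))) (T t (B (v n x))) < e" by blast
    qed
    then show ?thesis
      unfolding S_def by (intro convergent_LIMSEQ_iff[THEN iffD1] Cauchy_convergent)
  qed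
  have S_add: "S (x + y) = S x + S y" for x y
  proof (rule LIMSEQ_unique[OF S])
    have "T t (B (v n (x + y))) = T t (B (v n x)) + T t (B (v n y))" for n
      using t by (simp add: v_def V_add B_add T_add V_in_domain)
    then show "(\<lambda>n. T t (B (v n (x + y)))) \<longlonglongrightarrow> S x + S y"
      using tendsto_add[OF S S] by simp
  qed
  have S_scaleC: "S (a *\<^sub>C x) = a *\<^sub>C S x" for a x
  proof (rule LIMSEQ_unique[OF S])
    have "T t (B (v n (a *\<^sub>C x))) = a *\<^sub>C T t (B (v n x))" for n
      using t by (simp add: v_def V_scaleC B_scaleC T_scaleC V_in_domain)
    then show "(\<lambda>n. T t (B (v n (a *\<^sub>C x)))) \<longlonglongrightarrow> a *\<^sub>C S x"
      using scaleC.tendsto[OF tendsto_const S] by simp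
  qed
  have S_le: "norm (S x) \<le> c * norm x" for x
  proof (rule tendsto_le[OF _ tendsto_mult[OF tendsto_const tendsto_norm[OF v]] tendsto_norm[OF S]])
    show "\<forall>\<^sub>F n in sequentially. norm (T t (B (v n x))) \<le> c * norm (v n x)"
      unfolding c_def by (intro always_eventually allI norm_T_B_le t v_D)
  qed simp
  have S_D: "S x = T t (B x)" if "x \<in> D" for x
  proof (rule LIMSEQ_unique[OF S])
    have "(\<lambda>n. c * norm (v n x - x)) \<longlonglongrightarrow> c * norm (x - x)"
      by (intro tendsto_intros v)
    then have "(\<lambda>n. c * norm (v n x - x)) \<longlonglongrightarrow> 0" by simp
    then have "(\<lambda>n. T t (B (v n x)) - T t (B x)) \<longlonglongrightarrow> 0"
      by (rule Lim_null_comparison[OF always_eventually, rotated]) (intro allI diff v_D that)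
    then show "(\<lambda>n. T t (B (v n x))) \<longlonglongrightarrow> T t (B x)" by (rule LIM_zero_cancel)
  qed
  have "bounded_clinear S"
    unfolding bounded_clinear_def clinear_on_def using S_add S_scaleC S_le by blast
  moreover have "onorm S \<le> c" using c S_le by (rule onorm_bound)
  ultimately show ?thesis using S_D unfolding c_def by blast
qed

end

section \<open>Decay of order \<open>1/t\<close>\<close>

theorem theorem4p7:
  fixes T :: "real \<Rightarrow> 'a::chilbert_space \<Rightarrow> 'a"
    and D :: "'a set"
    and A B :: "'a \<Rightarrow> 'a"
  assumes "bounded_C0_semigroup T"
    and "is_generator T D (\<lambda>x. - A x)"
    and "clinear_on D B"
    and "graph_bounded_on D A B"
    and "\<And>t x. t \<ge> 0 \<Longrightarrow> x \<in> D \<Longrightarrow> T t (B x) = B (T t x)"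
    and "bdd_above {onorm (\<lambda>x. B (shift_inverse D A l x)) | l :: complex. Re l > 0}"
  shows "\<exists>S :: real \<Rightarrow> 'a \<Rightarrow> 'a.
           (\<forall>t>0. bounded_clinear (S t) \<and> (\<forall>x\<in>D. S t x = T t (B x))) \<and>
           (\<lambda>t. onorm (S t)) \<in> O[at_top](\<lambda>t. 1 / t)"
proof -
  obtain M0 where C0: "C0_semigroup T" and M0: "\<And>t. 0 \<le> t \<Longrightarrow> onorm (T t) \<le> M0"
    using assms(1) by (auto simp: bounded_C0_semigroup_def)
  obtain C where C: "\<And>x. x \<in> D \<Longrightarrow> norm (B x) \<le> C * (norm x + norm (A x))"
    using assms(4) by (auto simp: graph_bounded_on_def)
  obtain K0 where K0: "\<And>l. 0 < Re l \<Longrightarrow> onorm (\<lambda>x. B (shift_inverse D A l x)) \<le> K0"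
    using assms(6) unfolding bdd_above_def by auto
  define M where "M = max 1 M0"
  define K where "K = max 0 K0"
  interpret semigroup_generator T M D A
  proof
    show "norm (T t x) \<le> M * norm x" if "0 \<le> t" for t x
    proof -
      have "bounded_linear (T t)"
        using C0 that by (auto simp: C0_semigroup_def intro: bounded_clinear_imp_bounded_linear)
      then have "norm (T t x) \<le> onorm (T t) * norm x" by (rule onorm)
      also have "\<dots> \<le> M * norm x"
        using M0[OF that] by (intro mult_right_mono) (auto simp: M_def)
      finally show ?thesis .
    qed
  qed (use C0 assms(2) in \<open>auto simp: M_def\<close>)
  interpret commuting_operator T M D A B C K
  proof
    fix l x assume l: "0 < Re l"
    \<comment> \<open>The operator norm bounds the values only of an operator known to be bounded, and here this
      is the graph bound of \<open>B\<close>.\<close>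
    interpret R: bounded_linear "R l"
      by (rule bounded_clinear_imp_bounded_linear[OF bounded_clinear_resolvent[OF l]])
    obtain k where k: "\<And>x. norm (R l x) \<le> norm x * k" using R.bounded by blast
    have "bounded_linear (\<lambda>x. B (R l x))"
    proof (rule bounded_linear_intro)
      note D = resolvent_in_domain[OF l]
      show "B (R l (x + y)) = B (R l x) + B (R l y)" for x y
        using assms(3) D by (simp add: R.add clinear_on_def)
      show "B (R l (r *\<^sub>R x)) = r *\<^sub>R B (R l x)" for r x
        using assms(3) D unfolding R.scaleR clinear_on_def by (metis scaleC_complex_of_real)
      show "norm (B (R l x)) \<le> norm x * (\<bar>C\<bar> * (k + (1 + cmod l * k)))" for x
      proof -
        have "A (R l x) = x - l *\<^sub>C R l x"
          using resolvent_right[OF l, of x] by (simp add: algebra_simps)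
        then have "norm (A (R l x)) \<le> norm x + cmod l * norm (R l x)"
          using norm_triangle_ineq4[of x "l *\<^sub>C R l x"] by (simp add: norm_scaleC)
        also have "\<dots> \<le> norm x + cmod l * (norm x * k)"
          using k by (intro add_left_mono mult_left_mono) auto
        finally have "\<bar>C\<bar> * (norm (R l x) + norm (A (R l x)))
            \<le> \<bar>C\<bar> * (norm x * k + (norm x + cmod l * (norm x * k)))"
          by (intro mult_left_mono add_mono k) auto
        moreover have "norm (B (R l x)) \<le> \<bar>C\<bar> * (norm (R l x) + norm (A (R l x)))"
          using C[OF D[of x]] mult_right_mono[OF abs_ge_self[of C], of "norm (R l x) + norm (A (R l x))"]
          by simp
        ultimately show ?thesis by (simp add: algebra_simps)
      qed
    qed
    then have "norm (B (R l x)) \<le> onorm (\<lambda>x. B (R l x)) * norm x" by (rule onorm)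
    also have "\<dots> \<le> K * norm x"
      using K0[OF l] by (intro mult_right_mono) (auto simp: K_def)
    finally show "norm (B (R l x)) \<le> K * norm x" .
  qed (use assms C in \<open>auto simp: K_def\<close>)
  obtain S where S: "\<And>t. 0 < t \<Longrightarrow> bounded_clinear (S t) \<and> (\<forall>x\<in>D. S t x = T t (B x)) \<and>
      onorm (S t) \<le> 6 * K * M\<^sup>2 / t"
    using T_B_extension by metis
  have "(\<lambda>t. onorm (S t)) \<in> O[at_top](\<lambda>t. 1 / t)"
  proof (rule bigoI)
    show "\<forall>\<^sub>F t in at_top. norm (onorm (S t)) \<le> 6 * K * M\<^sup>2 * norm (1 / t)"
      using eventually_gt_at_top[of 0]
    proof eventually_elim
      case (elim t)
      then have "0 \<le> onorm (S t)"
        using S by (intro onorm_pos_le bounded_clinear_imp_bounded_linear) auto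
      then show ?case using S[OF elim] elim by simp
    qed
  qed
  then show ?thesis using S by blast
qed

end
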